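(* Consider, for coefficients $P,Q,R,S\in\mathbb{H}$, the equation $$X P X^* + X Q + R X^* = S$$ in the unknown $X\in\mathbb{H}$. For generic $P,Q,R,S\in\mathbb{H}$ with $P\neq 0$, this equation has two, one, or no solutions. However, there are two non-generic instances of $P,Q,R,S$ in which the equation admits infinitely many solutions, namely, a $3$-sphere of solutions or a circle of solutions.
   Context: $\mathbb{H}$ denotes the skew field of real quaternions, with standard real basis $1,\mathbf{i},\mathbf{j},\mathbf{k}$, identified as a vector space with Euclidean $\mathbb{R}^4$. For $X=x_0+x_1\mathbf{i}+x_2\mathbf{j}+x_3\mathbf{k}$ with $x_0,\ldots,x_3\in\mathbb{R}$, the conjugate is $X^*=x_0-x_1\mathbf{i}-x_2\mathbf{j}-x_3\mathbf{k}$, and $|X|^2=XX^*$. A $3$-sphere in $\mathbb{H}$ is a set $\{X\in\mathbb{H}: |X-C|=r\}$ with $C\in\mathbb{H}$, $r>0$; a circle in $\mathbb{H}$ is the set of points at a fixed distance $r>0$ from a point $C$ inside a real affine $2$-plane containing $C$. *)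

theory Defs
  imports "HOL-Analysis.Analysis"
begin

section \<open>The skew field of real quaternions\<close>

datatype quat = Quat (q0: real) (q1: real) (q2: real) (q3: real)

lemma quat_eq_iff: "x = y \<longleftrightarrow> q0 x = q0 y \<and> q1 x = q1 y \<and> q2 x = q2 y \<and> q3 x = q3 y"
  by (cases x; cases y) auto

instantiation quat :: real_vector
begin

definition "0 = Quat 0 0 0 0"
definition "x + y = Quat (q0 x + q0 y) (q1 x + q1 y) (q2 x + q2 y) (q3 x + q3 y)"
definition "- x = Quat (- q0 x) (- q1 x) (- q2 x) (- q3 x)"
definition "x - y = Quat (q0 x - q0 y) (q1 x - q1 y) (q2 x - q2 y) (q3 x - q3 y)"
definition "r *\<^sub>R x = Quat (r * q0 x) (r * q1 x) (r * q2 x) (r * q3 x)"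

instance
  by standard
    (simp_all add: zero_quat_def plus_quat_def uminus_quat_def minus_quat_def scaleR_quat_def
      quat_eq_iff algebra_simps)

end

lemma quat_zero_sel [simp]: "q0 0 = 0" "q1 0 = 0" "q2 0 = 0" "q3 0 = 0"
  by (simp_all add: zero_quat_def)

lemma quat_add_sel [simp]:
  "q0 (x + y) = q0 x + q0 y" "q1 (x + y) = q1 x + q1 y"
  "q2 (x + y) = q2 x + q2 y" "q3 (x + y) = q3 x + q3 y"
  by (simp_all add: plus_quat_def)

lemma quat_uminus_sel [simp]:
  "q0 (- x) = - q0 x" "q1 (- x) = - q1 x" "q2 (- x) = - q2 x" "q3 (- x) = - q3 x"
  by (simp_all add: uminus_quat_def)

lemma quat_minus_sel [simp]:
  "q0 (x - y) = q0 x - q0 y" "q1 (x - y) = q1 x - q1 y"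
  "q2 (x - y) = q2 x - q2 y" "q3 (x - y) = q3 x - q3 y"
  by (simp_all add: minus_quat_def)

lemma quat_scaleR_sel [simp]:
  "q0 (r *\<^sub>R x) = r * q0 x" "q1 (r *\<^sub>R x) = r * q1 x"
  "q2 (r *\<^sub>R x) = r * q2 x" "q3 (r *\<^sub>R x) = r * q3 x"
  by (simp_all add: scaleR_quat_def)

instantiation quat :: real_algebra_1
begin

definition "1 = Quat 1 0 0 0"

definition "x * y = Quat
  (q0 x * q0 y - q1 x * q1 y - q2 x * q2 y - q3 x * q3 y)
  (q0 x * q1 y + q1 x * q0 y + q2 x * q3 y - q3 x * q2 y)
  (q0 x * q2 y - q1 x * q3 y + q2 x * q0 y + q3 x * q1 y)
  (q0 x * q3 y + q1 x * q2 y - q2 x * q1 y + q3 x * q0 y)"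

instance
  by standard (simp_all add: one_quat_def times_quat_def quat_eq_iff algebra_simps)

end

lemma quat_one_sel [simp]: "q0 1 = 1" "q1 1 = 0" "q2 1 = 0" "q3 1 = 0"
  by (simp_all add: one_quat_def)

lemma quat_mult_sel [simp]:
  "q0 (x * y) = q0 x * q0 y - q1 x * q1 y - q2 x * q2 y - q3 x * q3 y"
  "q1 (x * y) = q0 x * q1 y + q1 x * q0 y + q2 x * q3 y - q3 x * q2 y"
  "q2 (x * y) = q0 x * q2 y - q1 x * q3 y + q2 x * q0 y + q3 x * q1 y"
  "q3 (x * y) = q0 x * q3 y + q1 x * q2 y - q2 x * q1 y + q3 x * q0 y"
  by (simp_all add: times_quat_def)

instantiation quat :: real_div_algebra
begin

definition "inverse x = (let n = (q0 x)\<^sup>2 + (q1 x)\<^sup>2 + (q2 x)\<^sup>2 + (q3 x)\<^sup>2 in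
  Quat (q0 x / n) (- q1 x / n) (- q2 x / n) (- q3 x / n))"

definition "x div y = x * inverse y" for x y :: quat

instance
proof
  fix x y :: quat
  show "x \<noteq> 0 \<Longrightarrow> inverse x * x = 1" "x \<noteq> 0 \<Longrightarrow> x * inverse x = 1"
  proof -
    assume "x \<noteq> 0"
    then have "(q0 x)\<^sup>2 + (q1 x)\<^sup>2 + (q2 x)\<^sup>2 + (q3 x)\<^sup>2 \<noteq> 0"
      by (simp add: quat_eq_iff add_nonneg_eq_0_iff)
    then show "inverse x * x = 1" "x * inverse x = 1"
      by (simp_all add: quat_eq_iff inverse_quat_def Let_def power2_eq_square
          add_divide_distrib [symmetric] diff_divide_distrib [symmetric])
  qed
  show "x div y = x * inverse y"
    by (fact divide_quat_def)
  show "inverse (0 :: quat) = 0"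
    by (simp add: quat_eq_iff inverse_quat_def)
qed

end

definition quat_i :: quat where "quat_i = Quat 0 1 0 0"
definition quat_j :: quat where "quat_j = Quat 0 0 1 0"
definition quat_k :: quat where "quat_k = Quat 0 0 0 1"

lemma quat_units_mult:
  "quat_i * quat_i = -1" "quat_j * quat_j = -1" "quat_k * quat_k = -1"
  "quat_i * quat_j = quat_k" "quat_j * quat_k = quat_i" "quat_k * quat_i = quat_j"
  "quat_j * quat_i = - quat_k" "quat_k * quat_j = - quat_i" "quat_i * quat_k = - quat_j"
  by (simp_all add: quat_eq_iff quat_i_def quat_j_def quat_k_def)

lemma quat_expansion:
  "x = of_real (q0 x) + q1 x *\<^sub>R quat_i + q2 x *\<^sub>R quat_j + q3 x *\<^sub>R quat_k"
  by (simp add: quat_eq_iff quat_i_def quat_j_def quat_k_def of_real_def)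

section \<open>Euclidean structure\<close>

instantiation quat :: real_inner
begin

definition inner_quat_def: "x \<bullet> y = q0 x * q0 y + q1 x * q1 y + q2 x * q2 y + q3 x * q3 y"

definition norm_quat_def: "norm x = sqrt ((q0 x)\<^sup>2 + (q1 x)\<^sup>2 + (q2 x)\<^sup>2 + (q3 x)\<^sup>2)"

definition sgn_quat_def: "sgn x = x /\<^sub>R norm x" for x :: quat

definition dist_quat_def: "dist x y = norm (x - y)" for x y :: quat

definition uniformity_quat_def:
  "(uniformity :: (quat \<times> quat) filter) = (INF e\<in>{0 <..}. principal {(x, y). dist x y < e})"

definition open_quat_def:
  "open (U :: quat set) \<longleftrightarrow> (\<forall>x\<in>U. eventually (\<lambda>(x', y). x' = x \<longrightarrow> y \<in> U) uniformity)"

instance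
proof
  fix x y z :: quat and r :: real
  show "x \<bullet> y = y \<bullet> x"
    by (simp add: inner_quat_def mult.commute)
  show "(x + y) \<bullet> z = x \<bullet> z + y \<bullet> z" "(r *\<^sub>R x) \<bullet> y = r * (x \<bullet> y)"
    by (simp_all add: inner_quat_def algebra_simps)
  show "0 \<le> x \<bullet> x"
    by (simp add: inner_quat_def)
  show "x \<bullet> x = 0 \<longleftrightarrow> x = 0"
    by (simp add: inner_quat_def quat_eq_iff add_nonneg_eq_0_iff)
  show "norm x = sqrt (x \<bullet> x)"
    by (simp add: norm_quat_def inner_quat_def power2_eq_square)
qed (rule sgn_quat_def dist_quat_def uniformity_quat_def open_quat_def)+

end

instance quat :: real_normed_div_algebra
proof
  fix x y :: quat
  show "norm (x * y) = norm x * norm y"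
    unfolding norm_quat_def real_sqrt_mult [symmetric]
    by (rule arg_cong [where f = sqrt]) (simp add: power2_eq_square algebra_simps)
qed

instantiation quat :: euclidean_space
begin

definition Basis_quat_def: "Basis = {1, quat_i, quat_j, quat_k}"

instance
proof
  fix u v x :: quat
  show "(Basis :: quat set) \<noteq> {}" "finite (Basis :: quat set)"
    by (simp_all add: Basis_quat_def)
  show "u \<in> Basis \<Longrightarrow> v \<in> Basis \<Longrightarrow> u \<bullet> v = (if u = v then 1 else 0)"
    unfolding Basis_quat_def
    by (elim insertE emptyE)
      (simp_all add: inner_quat_def quat_i_def quat_j_def quat_k_def quat_eq_iff)
  show "(\<forall>u\<in>Basis. x \<bullet> u = 0) \<longleftrightarrow> x = 0"
    by (simp add: Basis_quat_def inner_quat_def quat_i_def quat_j_def quat_k_def)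
      (simp add: quat_eq_iff)
qed

end

lemma DIM_quat [simp]: "DIM(quat) = 4"
  by (simp add: Basis_quat_def quat_i_def quat_j_def quat_k_def quat_eq_iff)

section \<open>Conjugation\<close>

definition qcnj :: "quat \<Rightarrow> quat" where
  "qcnj x = Quat (q0 x) (- q1 x) (- q2 x) (- q3 x)"

lemma qcnj_sel [simp]:
  "q0 (qcnj x) = q0 x" "q1 (qcnj x) = - q1 x" "q2 (qcnj x) = - q2 x" "q3 (qcnj x) = - q3 x"
  by (simp_all add: qcnj_def)

lemma mult_qcnj: "x * qcnj x = of_real ((norm x)\<^sup>2)"
  by (simp add: quat_eq_iff of_real_def norm_quat_def power2_eq_square algebra_simps)

section \<open>The equation, spheres, circles, and genericity\<close>

definition solutions :: "quat \<Rightarrow> quat \<Rightarrow> quat \<Rightarrow> quat \<Rightarrow> quat set" where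
  "solutions P Q R S = {X. X * P * qcnj X + X * Q + R * qcnj X = S}"

definition is_three_sphere :: "quat set \<Rightarrow> bool" where
  "is_three_sphere A \<longleftrightarrow> (\<exists>C r. r > 0 \<and> A = {X. norm (X - C) = r})"

definition is_circle :: "quat set \<Rightarrow> bool" where
  "is_circle A \<longleftrightarrow> (\<exists>E C r. affine E \<and> aff_dim E = 2 \<and> C \<in> E \<and> r > 0 \<and>
     A = {X \<in> E. norm (X - C) = r})"

text \<open>
  A property is generic if it holds outside a proper real algebraic subset of the ambient
  real vector space.  A common zero set of finitely many polynomials is the zero set of the
  sum of their squares, so a single polynomial suffices.
\<close>

definition proper_algebraic_subset :: "'a::real_normed_vector set \<Rightarrow> bool" where
  "proper_algebraic_subset Z \<longleftrightarrow>
     (\<exists>f. real_polynomial_function f \<and> Z = {x. f x = 0} \<and> Z \<noteq> UNIV)"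

end

theory Submission
  imports Defs
begin

text \<open>
  Write \<open>P = p0 + p\<close> with \<open>p0\<close> real and \<open>p\<close> pure imaginary, and put \<open>A = Q - R*\<close> and
  \<open>B = Q + R*\<close>.  Since \<open>X p X*\<close> is again pure imaginary, the equation splits into its vector
  part \<open>X p X* + Im (X A) = Im S\<close> and its scalar part \<open>p0 |X|^2 + Re (X B) = Re S\<close>; this is
  \<open>solutions_iff\<close>.

  If \<open>P\<close> is real, the vector part is linear.  For \<open>A \<noteq> 0\<close> it confines \<open>X\<close> to a real line, on
  which the scalar part is a genuine quadratic equation.  For \<open>A = 0\<close> it says nothing about \<open>X\<close>,
  and the scalar part alone describes a 3-sphere, a point or the empty set
  (\<open>solutions_real\<close>).

  If \<open>p \<noteq> 0\<close>, a translation \<open>X = C + Y\<close> removes the linear term of the vector part and leaves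
  \<open>Y p Y* = v\<close> with \<open>v\<close> pure imaginary (\<open>solutions_complete_square\<close>).  Two nonzero solutions of
  this differ by a unit quaternion that commutes with \<open>p\<close>, so for \<open>v \<noteq> 0\<close> they form a circle
  centred at \<open>0\<close> in the plane spanned by \<open>Y0\<close> and \<open>Y0 p\<close> (\<open>pure_conjugate_solutions\<close>).  As
  \<open>|Y|\<close> is constant there, the scalar part becomes affine in \<open>Y\<close>: either its linear form
  \<open>Re (Y D)\<close> does not vanish on the plane and cuts the circle in at most two points, or it
  vanishes there and keeps the whole circle or nothing.

  The form vanishes on the plane only if \<open>D v D*\<close> is a real multiple of \<open>p\<close>.  Cleared of denominators,
  this is a polynomial condition on the coefficients, \<open>degeneracy P Q R S = 0\<close>, which also holds
  for every real \<open>P\<close>; its zero set is the exceptional set.  The family \<open>X i X* + X + X* = s + 2j\<close>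
  lies outside it and has two, one or no solutions for \<open>s = 0, 2, 4\<close>.
\<close>

section \<open>Quaternion identities\<close>

definition qim :: "quat \<Rightarrow> quat" where
  "qim x = Quat 0 (q1 x) (q2 x) (q3 x)"

lemma qim_sel [simp]:
  "q0 (qim x) = 0" "q1 (qim x) = q1 x" "q2 (qim x) = q2 x" "q3 (qim x) = q3 x"
  by (simp_all add: qim_def)

lemma qim_add: "qim (x + y) = qim x + qim y"
  and qim_diff: "qim (x - y) = qim x - qim y"
  by (simp_all add: quat_eq_iff)

lemma of_real_quat_sel [simp]:
  "q0 (of_real r) = r" "q1 (of_real r) = 0" "q2 (of_real r) = 0" "q3 (of_real r) = 0"
  by (simp_all add: of_real_def)

lemma numeral_quat_sel [simp]:
  "q0 (numeral n) = numeral n" "q1 (numeral n) = 0" "q2 (numeral n) = 0" "q3 (numeral n) = 0"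
  using of_real_quat_sel [of "numeral n"] by simp_all

lemma quat_units_sel [simp]:
  "q0 quat_i = 0" "q1 quat_i = 1" "q2 quat_i = 0" "q3 quat_i = 0"
  "q0 quat_j = 0" "q1 quat_j = 0" "q2 quat_j = 1" "q3 quat_j = 0"
  "q0 quat_k = 0" "q1 quat_k = 0" "q2 quat_k = 0" "q3 quat_k = 1"
  by (simp_all add: quat_i_def quat_j_def quat_k_def)

lemma quat_times_of_real: "x * of_real r = r *\<^sub>R x" "of_real r * x = r *\<^sub>R x" for x :: quat
  by (simp_all add: quat_eq_iff)

lemma norm_quat_sq: "(norm x)\<^sup>2 = (q0 x)\<^sup>2 + (q1 x)\<^sup>2 + (q2 x)\<^sup>2 + (q3 x)\<^sup>2"
  by (simp add: norm_quat_def)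

lemma qcnj_simps [simp]:
  "qcnj (x * y) = qcnj y * qcnj x" "qcnj (x + y) = qcnj x + qcnj y" "qcnj (qcnj x) = x"
  "qcnj (- x) = - qcnj x" "qcnj (r *\<^sub>R x) = r *\<^sub>R qcnj x"
  by (simp_all add: quat_eq_iff)

lemma qcnj_0 [simp]: "qcnj 0 = 0"
  by (simp add: quat_eq_iff)

lemma qcnj_eq_0_iff [simp]: "qcnj x = 0 \<longleftrightarrow> x = 0"
  by (auto simp: quat_eq_iff)

lemma norm_qcnj [simp]: "norm (qcnj x) = norm x"
  by (simp add: norm_quat_def)

lemma qcnj_mult: "qcnj x * x = of_real ((norm x)\<^sup>2)"
  using mult_qcnj [of "qcnj x"] by simp

lemma qcnj_pure: "q0 x = 0 \<Longrightarrow> qcnj x = - x"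
  by (simp add: quat_eq_iff)

lemma pure_square: "q0 x = 0 \<Longrightarrow> x * x = - of_real ((norm x)\<^sup>2)"
  using mult_qcnj [of x] by (metis qcnj_pure mult_minus_right minus_minus)

lemma q0_mult_commute: "q0 (x * y) = q0 (y * x)"
  by (simp add: algebra_simps)

lemma q0_mult_qcnj: "q0 (x * qcnj y) = x \<bullet> y"
  by (simp add: inner_quat_def)

lemma pure_conjugate: "q0 p = 0 \<Longrightarrow> q0 (x * p * qcnj x) = 0"
  by (simp add: algebra_simps)

section \<open>Vector part and scalar part of the equation\<close>

lemma solutions_iff:
  "X \<in> solutions P Q R S \<longleftrightarrow>
     X * qim P * qcnj X + qim (X * (Q - qcnj R)) = qim S \<and>
     q0 P * (norm X)\<^sup>2 + q0 (X * (Q + qcnj R)) = q0 S"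
proof -
  define L where "L = X * P * qcnj X + X * Q + R * qcnj X"
  have P: "P = of_real (q0 P) + qim P"
    by (simp add: quat_eq_iff)
  define r Y where "r = q0 P * (norm X)\<^sup>2" and "Y = X * qim P * qcnj X"
  have "X * P * qcnj X = of_real r + Y"
    by (subst P)
      (simp add: distrib_left distrib_right quat_times_of_real mult_qcnj r_def Y_def)
  moreover have "q0 Y = 0"
    unfolding Y_def by (rule pure_conjugate) simp
  ultimately have "qim (X * P * qcnj X) = Y" and "q0 (X * P * qcnj X) = r"
    by (simp_all add: quat_eq_iff del: quat_mult_sel)
  moreover have "qim (R * qcnj X) = - qim (X * qcnj R)" "q0 (R * qcnj X) = q0 (X * qcnj R)"
    by (simp_all add: quat_eq_iff)
  ultimately have "qim L = X * qim P * qcnj X + qim (X * (Q - qcnj R))"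
    and "q0 L = q0 P * (norm X)\<^sup>2 + q0 (X * (Q + qcnj R))"
    unfolding L_def right_diff_distrib distrib_left qim_add qim_diff quat_add_sel
      Y_def [symmetric] r_def [symmetric]
    by (simp_all del: quat_mult_sel)
  moreover have "L = S \<longleftrightarrow> qim L = qim S \<and> q0 L = q0 S"
    by (auto simp: quat_eq_iff)
  ultimately show ?thesis
    by (simp only: solutions_def mem_Collect_eq L_def)
qed

section \<open>Intersections of lines, planes and spheres\<close>

text \<open>
  Along the line, a quadric with \<open>c \<noteq> 0\<close> is the zero set of a polynomial in \<open>t\<close> whose leading
  coefficient \<open>c |V|^2\<close> does not vanish.
\<close>

lemma card_le_two_on_line:
  fixes A :: "'a::real_inner set"
  assumes line: "A \<subseteq> range (\<lambda>t. U + t *\<^sub>R V)" and "V \<noteq> 0"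
    and quadric: "\<And>X. X \<in> A \<Longrightarrow> c * (norm X)\<^sup>2 + X \<bullet> B = d" and "c \<noteq> 0"
  shows "finite A \<and> card A \<le> 2"
proof -
  define g where "g = [:c * (U \<bullet> U) + U \<bullet> B - d, c * 2 * (U \<bullet> V) + V \<bullet> B, c * (V \<bullet> V):]"
  have nz: "c * (V \<bullet> V) \<noteq> 0"
    using assms by simp
  then have "g \<noteq> 0" and deg: "degree g = 2"
    by (simp_all add: g_def)
  then have fin: "finite {t. poly g t = 0}" and card: "card {t. poly g t = 0} \<le> 2"
    using poly_roots_finite [of g] card_poly_roots_bound [of g] by auto
  have sub: "A \<subseteq> (\<lambda>t. U + t *\<^sub>R V) ` {t. poly g t = 0}"
  proof
    fix X assume X: "X \<in> A"
    then obtain t where t: "X = U + t *\<^sub>R V"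
      using line by auto
    have "poly g t = c * (norm X)\<^sup>2 + X \<bullet> B - d"
      by (simp add: g_def t power2_norm_eq_inner algebra_simps inner_commute)
    then show "X \<in> (\<lambda>t. U + t *\<^sub>R V) ` {t. poly g t = 0}"
      using quadric [OF X] t by auto
  qed
  show ?thesis
    using finite_subset [OF sub] surj_card_le [OF fin sub] fin card by auto
qed

text \<open>
  A linear form that does not vanish on the plane cuts it in a line, and a line meets a sphere at
  most twice.
\<close>

lemma card_circle_inter_hyperplane_le_two:
  fixes e f G :: "'a::real_inner"
  assumes "e \<noteq> 0" "f \<noteq> 0" "e \<bullet> f = 0" and transversal: "e \<bullet> G \<noteq> 0 \<or> f \<bullet> G \<noteq> 0"
  shows "finite {Y \<in> span {e, f}. norm Y = r \<and> Y \<bullet> G = k} \<and>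
    card {Y \<in> span {e, f}. norm Y = r \<and> Y \<bullet> G = k} \<le> 2"
proof (rule card_le_two_on_line)
  define \<alpha> \<beta> where "\<alpha> = e \<bullet> G" and "\<beta> = f \<bullet> G"
  define N where "N = \<alpha>\<^sup>2 + \<beta>\<^sup>2"
  have "N > 0"
    using transversal by (auto simp: N_def \<alpha>_def \<beta>_def sum_power2_gt_zero_iff)
  \<comment> \<open>\<open>U\<close> is a point of the plane with \<open>U \<bullet> G = k\<close>; \<open>V\<close> spans the kernel of
    \<open>\<lambda>Y. Y \<bullet> G\<close> in the plane.\<close>
  define U V where "U = (k / N) *\<^sub>R (\<alpha> *\<^sub>R e + \<beta> *\<^sub>R f)" and "V = \<alpha> *\<^sub>R f - \<beta> *\<^sub>R e"
  have "V \<bullet> V = \<alpha>\<^sup>2 * (f \<bullet> f) + \<beta>\<^sup>2 * (e \<bullet> e)"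
    using assms(3) by (simp add: V_def algebra_simps inner_commute power2_eq_square)
  also have "\<dots> > 0"
    using transversal \<open>e \<noteq> 0\<close> \<open>f \<noteq> 0\<close>
    by (auto simp: \<alpha>_def \<beta>_def intro: add_pos_nonneg add_nonneg_pos)
  finally show "V \<noteq> 0"
    by auto
  show "{Y \<in> span {e, f}. norm Y = r \<and> Y \<bullet> G = k} \<subseteq> range (\<lambda>t. U + t *\<^sub>R V)"
  proof
    fix Y assume "Y \<in> {Y \<in> span {e, f}. norm Y = r \<and> Y \<bullet> G = k}"
    then obtain a b where Y: "Y = a *\<^sub>R e + b *\<^sub>R f" and "Y \<bullet> G = k"
      by (auto simp: span_breakdown_eq span_singleton algebra_simps)
    then have k: "k = a * \<alpha> + b * \<beta>"
      by (simp add: \<alpha>_def \<beta>_def inner_add_left)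
    have "N *\<^sub>R Y = N *\<^sub>R (U + ((b * \<alpha> - a * \<beta>) / N) *\<^sub>R V)"
    proof -
      have "N *\<^sub>R (U + ((b * \<alpha> - a * \<beta>) / N) *\<^sub>R V) =
          (k * \<alpha> - (b * \<alpha> - a * \<beta>) * \<beta>) *\<^sub>R e + (k * \<beta> + (b * \<alpha> - a * \<beta>) * \<alpha>) *\<^sub>R f"
        using \<open>N > 0\<close>
        by (simp add: U_def V_def scaleR_right_distrib scaleR_right_diff_distrib
            scaleR_left_diff_distrib scaleR_left_distrib)
      also have "k * \<alpha> - (b * \<alpha> - a * \<beta>) * \<beta> = N * a"
        by (simp add: k N_def algebra_simps power2_eq_square)
      also have "k * \<beta> + (b * \<alpha> - a * \<beta>) * \<alpha> = N * b"
        by (simp add: k N_def algebra_simps power2_eq_square)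
      finally show ?thesis
        by (simp add: Y algebra_simps)
    qed
    then have "Y = U + ((b * \<alpha> - a * \<beta>) / N) *\<^sub>R V"
      using \<open>N > 0\<close> by simp
    then show "Y \<in> range (\<lambda>t. U + t *\<^sub>R V)"
      by blast
  qed
  show "1 * (norm Y)\<^sup>2 + Y \<bullet> 0 = r\<^sup>2" if "Y \<in> {Y \<in> span {e, f}. norm Y = r \<and> Y \<bullet> G = k}" for Y
    using that by simp
qed simp

lemma is_circle_translated_plane_circle:
  assumes "e \<noteq> 0" "f \<noteq> 0" "e \<bullet> f = 0" "r > 0"
  shows "is_circle ((+) C ` {Y \<in> span {e, f}. norm Y = r})"
proof -
  let ?E = "(+) C ` span {e, f}"
  have "e \<noteq> f"
    using assms by auto
  have "independent {e, f}"
    by (rule pairwise_orthogonal_independent)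
      (use assms in \<open>auto simp: pairwise_def orthogonal_def inner_commute\<close>)
  then have "dim (span {e, f}) = 2"
    using \<open>e \<noteq> f\<close> by (simp add: dim_eq_card_independent)
  then have "aff_dim ?E = 2"
    by (simp only: aff_dim_translation_eq aff_dim_subspace [OF subspace_span])
  moreover have "affine ?E"
    using affine_translation subspace_imp_affine subspace_span by blast
  moreover have "C \<in> ?E"
    by (auto simp: image_iff intro: span_zero bexI [of _ 0])
  moreover have "(+) C ` {Y \<in> span {e, f}. norm Y = r} = {X \<in> ?E. norm (X - C) = r}"
    by auto
  ultimately show ?thesis
    unfolding is_circle_def using \<open>r > 0\<close> by blast
qed

text \<open>
  Completing the square turns the equation into \<open>|X - C|^2 = m\<close>; the sign of \<open>m\<close> decides.
\<close>

lemma three_sphere_trichotomy: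
  fixes B :: quat and d :: real
  assumes "a \<noteq> 0"
  defines "M \<equiv> {X. a * (norm X)\<^sup>2 + X \<bullet> B = d}"
  shows "finite M \<and> card M \<le> 2 \<or> is_three_sphere M"
proof -
  define C where "C = - (1 / (2 * a)) *\<^sub>R B"
  define m where "m = d / a + C \<bullet> C"
  have "a * (norm X)\<^sup>2 + X \<bullet> B = d \<longleftrightarrow> (norm (X - C))\<^sup>2 = m" for X
  proof -
    have "a * (norm (X - C))\<^sup>2 = a * (norm X)\<^sup>2 + X \<bullet> B + a * (C \<bullet> C)"
      using assms(1) by (simp add: C_def power2_norm_eq_inner algebra_simps inner_commute)
    moreover have "a * m = d + a * (C \<bullet> C)"
      using assms(1) by (simp add: m_def algebra_simps)
    ultimately show ?thesis
      using assms(1) by (metis add_right_cancel mult_left_cancel)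
  qed
  then have M: "M = {X. (norm (X - C))\<^sup>2 = m}"
    by (simp add: M_def)
  consider "m < 0" | "m = 0" | "m > 0"
    by linarith
  then show ?thesis
  proof cases
    case 1
    then have "M = {}"
      unfolding M by (auto simp: not_less [symmetric])
    then show ?thesis
      by simp
  next
    case 2
    then have "M = {C}"
      unfolding M by auto
    then show ?thesis
      by simp
  next
    case 3
    then have "M = {X. norm (X - C) = sqrt m}"
      unfolding M by (auto simp: real_sqrt_unique)
    then show ?thesis
      unfolding is_three_sphere_def using 3 by (metis real_sqrt_gt_zero)
  qed
qed

section \<open>The equation \<open>Y p Y* = v\<close> for pure imaginary \<open>p\<close> and \<open>v\<close>\<close>

text \<open>
  Taking norms determines \<open>|Y|\<close>; once \<open>|Y|\<close> is known, multiplying by \<open>Y\<close> on the right makes the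
  equation linear in \<open>Y\<close>.
\<close>

lemma pure_conjugate_eq_iff:
  assumes p: "q0 p = 0" "p \<noteq> 0" and v: "q0 v = 0" "v \<noteq> 0"
  defines "\<rho> \<equiv> norm v / norm p"
  shows "Y * p * qcnj Y = v \<longleftrightarrow> \<rho> *\<^sub>R (Y * p) = v * Y \<and> (norm Y)\<^sup>2 = \<rho>"
proof
  assume L: "Y * p * qcnj Y = v"
  then have "norm Y * norm p * norm Y = norm v"
    using norm_mult [of "Y * p" "qcnj Y"] by (simp add: norm_mult)
  then have n: "(norm Y)\<^sup>2 = \<rho>"
    using p by (simp add: \<rho>_def field_simps power2_eq_square)
  have "v * Y = Y * p * (qcnj Y * Y)"
    using L by (metis mult.assoc)
  also have "\<dots> = \<rho> *\<^sub>R (Y * p)"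
    by (simp only: qcnj_mult n) (simp add: quat_times_of_real)
  finally show "\<rho> *\<^sub>R (Y * p) = v * Y \<and> (norm Y)\<^sup>2 = \<rho>"
    using n by simp
next
  assume R: "\<rho> *\<^sub>R (Y * p) = v * Y \<and> (norm Y)\<^sup>2 = \<rho>"
  have "\<rho> *\<^sub>R (Y * p * qcnj Y) = v * (Y * qcnj Y)"
    using R by (metis mult.assoc mult_scaleR_left)
  also have "\<dots> = \<rho> *\<^sub>R v"
    using R by (simp add: mult_qcnj quat_times_of_real flip: of_real_power)
  finally show "Y * p * qcnj Y = v"
    using p v by (simp add: \<rho>_def)
qed

text \<open>
  This is the fact that rotations act transitively on the directions of 3-space.  The map \<open>F\<close>
  below averages any quaternion into a solution of the linear equation \<open>\<rho> Y p = v Y\<close>, because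
  \<open>p^2\<close> and \<open>v^2\<close> are real.
\<close>

lemma pure_conjugate_exists:
  assumes p: "q0 p = 0" "p \<noteq> 0" and v: "q0 v = 0" "v \<noteq> 0"
  obtains Y where "Y \<noteq> 0" "Y * p * qcnj Y = v"
proof -
  define \<rho> where "\<rho> = norm v / norm p"
  have "\<rho> > 0"
    using p v by (simp add: \<rho>_def)
  define F where "F w = \<rho> *\<^sub>R (w * p) + v * w" for w
  have F: "\<rho> *\<^sub>R (F w * p) = v * F w" for w
  proof -
    have "w * p * p = - (norm p)\<^sup>2 *\<^sub>R w" "v * v * w = - (norm v)\<^sup>2 *\<^sub>R w"
      using pure_square [OF p(1)] pure_square [OF v(1)]
      by (simp_all add: mult.assoc quat_times_of_real flip: of_real_power)
    then have "F w * p = v * w * p - (\<rho> * (norm p)\<^sup>2) *\<^sub>R w"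
      and "v * F w = \<rho> *\<^sub>R (v * w * p) - (norm v)\<^sup>2 *\<^sub>R w"
      by (simp_all add: F_def distrib_left distrib_right flip: mult.assoc)
    moreover have "\<rho> * (\<rho> * (norm p)\<^sup>2) = (norm v)\<^sup>2"
      using p by (simp add: \<rho>_def field_simps power2_eq_square)
    ultimately show ?thesis
      by (simp only: scaleR_right_diff_distrib scaleR_scaleR)
  qed
  have "\<exists>w. F w \<noteq> 0"
  proof (rule ccontr)
    assume "\<nexists>w. F w \<noteq> 0"
    \<comment> \<open>\<open>F 1 = 0\<close> gives \<open>v = - \<rho> p\<close>; then the other two equations make \<open>p\<close> commute with
      \<open>i\<close> and \<open>j\<close>, that is, make it real.\<close>
    then have "F 1 = 0" "F quat_i = 0" "F quat_j = 0"
      by auto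
    then show False
      using p v \<open>\<rho> > 0\<close> by (auto simp: F_def quat_eq_iff)
  qed
  then obtain w where w: "F w \<noteq> 0" ..
  define Y where "Y = (sqrt \<rho> / norm (F w)) *\<^sub>R F w"
  have "(norm Y)\<^sup>2 = \<rho>"
    using w \<open>\<rho> > 0\<close> by (simp add: Y_def)
  moreover have "\<rho> *\<^sub>R (Y * p) = v * Y"
  proof -
    have "\<rho> *\<^sub>R (Y * p) = (sqrt \<rho> / norm (F w)) *\<^sub>R (\<rho> *\<^sub>R (F w * p))"
      by (simp add: Y_def mult.commute)
    also have "\<dots> = v * Y"
      unfolding F by (simp add: Y_def)
    finally show ?thesis .
  qed
  ultimately have "Y * p * qcnj Y = v"
    unfolding pure_conjugate_eq_iff [OF p v] \<rho>_def by (intro conjI)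
  moreover have "Y \<noteq> 0"
    using \<open>(norm Y)\<^sup>2 = \<rho>\<close> \<open>\<rho> > 0\<close> by auto
  ultimately show thesis
    by (rule that [rotated])
qed

text \<open>
  If \<open>Im u\<close> commutes with \<open>p\<close>, then the product \<open>Im u p\<close> equals its own conjugate, so it is a real
  number \<open>r\<close>; multiplying once more by \<open>p\<close> exhibits \<open>Im u\<close> as a multiple of \<open>p\<close>.
\<close>

lemma commute_pure_imp:
  assumes p: "q0 p = 0" "p \<noteq> 0" and comm: "u * p = p * u"
  shows "\<exists>a b. u = of_real a + b *\<^sub>R p"
proof -
  define r where "r = q0 (qim u * p)"
  have "qim u * p = of_real r"
    using comm p by (simp add: r_def quat_eq_iff algebra_simps)
  then have "qim u * (p * p) = r *\<^sub>R p"
    by (simp add: quat_times_of_real flip: mult.assoc)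
  then have "r *\<^sub>R p = - ((norm p)\<^sup>2 *\<^sub>R qim u)"
    by (simp add: pure_square [OF p(1)] quat_times_of_real flip: of_real_power)
  then have "(norm p)\<^sup>2 *\<^sub>R qim u = (- r) *\<^sub>R p"
    by simp
  then have "inverse ((norm p)\<^sup>2) *\<^sub>R ((norm p)\<^sup>2 *\<^sub>R qim u) = inverse ((norm p)\<^sup>2) *\<^sub>R ((- r) *\<^sub>R p)"
    by (simp only:)
  then have "qim u = (inverse ((norm p)\<^sup>2) * - r) *\<^sub>R p"
    using p by (simp only: scaleR_scaleR) simp
  moreover have "u = of_real (q0 u) + qim u"
    by (simp add: quat_eq_iff)
  ultimately show ?thesis
    by metis
qed

text \<open>
  For any other solution \<open>Y = Y0 u\<close> of the linear equation \<open>\<rho> Y p = v Y\<close>, the factor \<open>u\<close> commutes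
  with \<open>p\<close> and so lies in the span of \<open>1\<close> and \<open>p\<close>.
\<close>

lemma pure_conjugate_solutions:
  assumes p: "q0 p = 0" "p \<noteq> 0" and v: "v \<noteq> 0" and Y0: "Y0 * p * qcnj Y0 = v"
  shows "Y * p * qcnj Y = v \<longleftrightarrow> Y \<in> span {Y0, Y0 * p} \<and> norm Y = norm Y0"
proof -
  define \<rho> where "\<rho> = norm v / norm p"
  have v0: "q0 v = 0"
    using Y0 p pure_conjugate by blast
  have "\<rho> \<noteq> 0"
    using p v by (simp add: \<rho>_def)
  have "Y0 \<noteq> 0"
    using Y0 v by auto
  have iff: "X * p * qcnj X = v \<longleftrightarrow> \<rho> *\<^sub>R (X * p) = v * X \<and> (norm X)\<^sup>2 = \<rho>" for X
    unfolding \<rho>_def by (rule pure_conjugate_eq_iff) (use p v v0 in auto)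
  have Y0p: "\<rho> *\<^sub>R (Y0 * p) = v * Y0" and Y0n: "(norm Y0)\<^sup>2 = \<rho>"
    using iff Y0 by auto
  have plane: "\<rho> *\<^sub>R (Y * p) = v * Y \<longleftrightarrow> Y \<in> span {Y0, Y0 * p}"
  proof
    assume Yp: "\<rho> *\<^sub>R (Y * p) = v * Y"
    define u where "u = inverse Y0 * Y"
    have Y: "Y = Y0 * u"
      using \<open>Y0 \<noteq> 0\<close> by (simp add: u_def flip: mult.assoc)
    have "\<rho> *\<^sub>R (Y0 * (u * p)) = \<rho> *\<^sub>R (Y0 * (p * u))"
      using Yp Y0p by (metis Y mult.assoc mult_scaleR_left)
    then have "u * p = p * u"
      using \<open>\<rho> \<noteq> 0\<close> \<open>Y0 \<noteq> 0\<close> by simp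
    then obtain a b where "u = of_real a + b *\<^sub>R p"
      using commute_pure_imp [OF p] by blast
    then have "Y = a *\<^sub>R Y0 + b *\<^sub>R (Y0 * p)"
      by (simp add: Y distrib_left quat_times_of_real)
    then show "Y \<in> span {Y0, Y0 * p}"
      by (simp add: span_add span_scale span_base)
  next
    assume "Y \<in> span {Y0, Y0 * p}"
    then obtain a b where Y: "Y = a *\<^sub>R Y0 + b *\<^sub>R (Y0 * p)"
      by (auto simp: span_breakdown_eq span_singleton algebra_simps)
    have "\<rho> *\<^sub>R (Y * p) = a *\<^sub>R (\<rho> *\<^sub>R (Y0 * p)) + b *\<^sub>R (\<rho> *\<^sub>R (Y0 * p) * p)"
      by (simp add: Y algebra_simps)
    also have "\<dots> = v * Y"
      by (simp only: Y0p) (simp add: Y algebra_simps)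
    finally show "\<rho> *\<^sub>R (Y * p) = v * Y" .
  qed
  have "(norm Y)\<^sup>2 = \<rho> \<longleftrightarrow> norm Y = norm Y0"
    using Y0n by (metis norm_ge_zero power2_eq_iff_nonneg)
  with iff plane show ?thesis
    by blast
qed

section \<open>Coefficients \<open>P\<close> that are not real\<close>

lemma qim_pure: "q0 x = 0 \<Longrightarrow> qim x = x"
  by (simp add: quat_eq_iff)

lemma polarized_conjugate:
  assumes "q0 p = 0"
  shows "Y * p * qcnj C + C * p * qcnj Y = qim (Y * (2 *\<^sub>R (p * qcnj C)))"
  using assms by (simp add: quat_eq_iff algebra_simps)

text \<open>
  The translation \<open>C\<close> is chosen such that \<open>2 p C* = - A\<close>, so that the terms linear in \<open>Y\<close> cancel in
  the vector part.
\<close>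

lemma solutions_complete_square:
  fixes P Q R S
  defines "p \<equiv> qim P" and "A \<equiv> Q - qcnj R" and "B \<equiv> Q + qcnj R"
  defines "C \<equiv> - (1 / (2 * (p \<bullet> p))) *\<^sub>R (qcnj A * p)"
  defines "v \<equiv> qim S + (1 / (4 * (p \<bullet> p))) *\<^sub>R (qcnj A * p * A)"
  defines "D \<equiv> B + (2 * q0 P) *\<^sub>R qcnj C"
  defines "k \<equiv> q0 S - q0 P * (norm C)\<^sup>2 - q0 (C * B)"
  assumes "p \<noteq> 0"
  shows "solutions P Q R S = (+) C ` {Y. Y * p * qcnj Y = v \<and> q0 P * (norm Y)\<^sup>2 + Y \<bullet> qcnj D = k}"
proof -
  have p0: "q0 p = 0"
    by (simp add: p_def)
  have pp: "p \<bullet> p \<noteq> 0"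
    using \<open>p \<noteq> 0\<close> by simp
  have p2: "p * p = - (p \<bullet> p) *\<^sub>R 1"
    using pure_square [OF p0] by (simp add: power2_norm_eq_inner of_real_def)
  have cC: "qcnj C = (1 / (2 * (p \<bullet> p))) *\<^sub>R (p * A)"
    by (simp add: C_def qcnj_pure [OF p0])
  have "p * (p * A) = - (p \<bullet> p) *\<^sub>R A"
    unfolding mult.assoc [symmetric] p2 by simp
  then have kill: "2 *\<^sub>R (p * qcnj C) = - A"
    using pp by (simp add: cC)
  have imA: "qim (qcnj A * p * A) = qcnj A * p * A"
    using p0 pure_conjugate [of p "qcnj A"] by (simp add: qim_pure)
  have const: "qim S - (C * p * qcnj C + qim (C * A)) = v"
  proof -
    have "C * p * qcnj C = (1 / (4 * (p \<bullet> p))) *\<^sub>R (qcnj A * p * A)"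
    proof -
      have "C * p * qcnj C = - (1 / 2) *\<^sub>R (C * A)"
        using arg_cong [OF kill, of "\<lambda>x. (1 / 2) *\<^sub>R (C * x)"] by (simp add: mult.assoc)
      then show ?thesis
        by (simp add: C_def)
    qed
    moreover have "qim (C * A) = - (1 / (2 * (p \<bullet> p))) *\<^sub>R (qcnj A * p * A)"
      using imA by (simp add: C_def quat_eq_iff)
    ultimately show ?thesis
      by (simp add: v_def quat_eq_iff field_simps)
  qed
  have vector: "(C + Y) * p * qcnj (C + Y) + qim ((C + Y) * A) = qim S \<longleftrightarrow> Y * p * qcnj Y = v" for Y
  proof -
    have "(C + Y) * p * qcnj (C + Y) + qim ((C + Y) * A) =
        Y * p * qcnj Y + (Y * p * qcnj C + C * p * qcnj Y) + qim (Y * A) + (C * p * qcnj C + qim (C * A))"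
      by (simp add: qim_add algebra_simps)
    also have "(Y * p * qcnj C + C * p * qcnj Y) = - qim (Y * A)"
      unfolding polarized_conjugate [OF p0] kill by (simp add: quat_eq_iff)
    finally have "(C + Y) * p * qcnj (C + Y) + qim ((C + Y) * A) =
        Y * p * qcnj Y + (C * p * qcnj C + qim (C * A))"
      by (simp only: add.assoc add.left_inverse add_0_left minus_add_cancel)
    then show ?thesis
      unfolding const [symmetric] by (simp only: eq_diff_eq)
  qed
  have scalar: "q0 P * (norm (C + Y))\<^sup>2 + q0 ((C + Y) * B) = q0 S \<longleftrightarrow>
      q0 P * (norm Y)\<^sup>2 + Y \<bullet> qcnj D = k" for Y
  proof -
    have "Y \<bullet> qcnj D = q0 (Y * B) + 2 * q0 P * (Y \<bullet> C)"
      unfolding D_def by (simp add: inner_quat_def algebra_simps)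
    moreover have "(norm (C + Y))\<^sup>2 = (norm C)\<^sup>2 + 2 * (Y \<bullet> C) + (norm Y)\<^sup>2"
      by (simp add: power2_norm_eq_inner algebra_simps inner_commute)
    moreover have "q0 ((C + Y) * B) = q0 (C * B) + q0 (Y * B)"
      by (simp add: distrib_right del: quat_mult_sel)
    ultimately show ?thesis
      unfolding k_def by (simp only:) (auto simp: algebra_simps simp del: quat_mult_sel)
  qed
  have sol: "C + Y \<in> solutions P Q R S \<longleftrightarrow>
      Y \<in> {Y. Y * p * qcnj Y = v \<and> q0 P * (norm Y)\<^sup>2 + Y \<bullet> qcnj D = k}" for Y
    by (simp only: solutions_iff p_def [symmetric] A_def [symmetric] B_def [symmetric]
        vector scalar mem_Collect_eq)
  show ?thesis
  proof (intro set_eqI iffI)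
    fix X assume "X \<in> solutions P Q R S"
    then show "X \<in> (+) C ` {Y. Y * p * qcnj Y = v \<and> q0 P * (norm Y)\<^sup>2 + Y \<bullet> qcnj D = k}"
      using sol [of "X - C"] by (intro image_eqI [of _ _ "X - C"]) simp_all
  next
    fix X assume "X \<in> (+) C ` {Y. Y * p * qcnj Y = v \<and> q0 P * (norm Y)\<^sup>2 + Y \<bullet> qcnj D = k}"
    then show "X \<in> solutions P Q R S"
      using sol by blast
  qed
qed

text \<open>
  With \<open>v\<close> and \<open>D\<close> as in \<open>solutions_complete_square\<close>, \<open>E = p D\<close> and \<open>W = 4 |p|^2 v\<close> when
  \<open>p \<noteq> 0\<close>; the multiples are chosen to make \<open>E\<close> and \<open>W\<close> polynomial in the coefficients.  The
  pure imaginary quaternion \<open>T\<close> commutes with \<open>p\<close> iff it is a multiple of \<open>p\<close> or \<open>p = 0\<close>.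
\<close>

definition degeneracy :: "quat \<Rightarrow> quat \<Rightarrow> quat \<Rightarrow> quat \<Rightarrow> quat" where
  "degeneracy P Q R S =
    (let p = qim P; A = Q - qcnj R; B = Q + qcnj R;
         E = p * B - q0 P *\<^sub>R A; W = (4 * (p \<bullet> p)) *\<^sub>R qim S + qcnj A * p * A;
         T = E * W * qcnj E
     in T * p - p * T)"

text \<open>
  The two hypotheses say that \<open>H = D Y\<close> is pure imaginary and orthogonal to \<open>p\<close>, so that \<open>H\<close> and
  \<open>p\<close> anticommute, which makes \<open>H p H* = - |H|^2 p\<close> a multiple of \<open>p\<close>.
\<close>

lemma commute_conjugate_of_orthogonal:
  assumes p: "q0 p = 0" and orth: "q0 (Y * D) = 0" "q0 (Y * p * D) = 0"
  shows "\<exists>c. (p * D) * (Y * p * qcnj Y) * qcnj (p * D) = c *\<^sub>R p"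
proof -
  define H where "H = D * Y"
  have "q0 H = 0" "q0 (p * H) = 0"
    using orth q0_mult_commute unfolding H_def by (metis mult.assoc)+
  then have anti: "H * p = - (p * H)"
    using p by (simp add: quat_eq_iff algebra_simps)
  have "(p * D) * (Y * p * qcnj Y) * qcnj (p * D) = p * (H * p) * qcnj H * qcnj p"
    by (simp add: H_def mult.assoc)
  also have "\<dots> = - (p * p * (H * qcnj H) * qcnj p)"
    unfolding anti by (simp add: mult.assoc)
  also have "\<dots> = (- (norm p)\<^sup>2 * (norm H)\<^sup>2) *\<^sub>R p"
    by (simp add: mult_qcnj pure_square [OF p] qcnj_pure [OF p] quat_times_of_real flip: of_real_power)
  finally show ?thesis
    by blast
qed

lemma solutions_nonreal:
  assumes "qim P \<noteq> 0"
  shows "finite (solutions P Q R S) \<and> card (solutions P Q R S) \<le> 2 \<or>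
    degeneracy P Q R S = 0 \<and> is_circle (solutions P Q R S)"
proof -
  define p A B where "p = qim P" and "A = Q - qcnj R" and "B = Q + qcnj R"
  define C where "C = - (1 / (2 * (p \<bullet> p))) *\<^sub>R (qcnj A * p)"
  define v where "v = qim S + (1 / (4 * (p \<bullet> p))) *\<^sub>R (qcnj A * p * A)"
  define D where "D = B + (2 * q0 P) *\<^sub>R qcnj C"
  define k where "k = q0 S - q0 P * (norm C)\<^sup>2 - q0 (C * B)"
  define M where "M = {Y. Y * p * qcnj Y = v \<and> q0 P * (norm Y)\<^sup>2 + Y \<bullet> qcnj D = k}"
  have sol: "solutions P Q R S = (+) C ` M"
    using solutions_complete_square [OF assms, of Q R S]
    unfolding M_def k_def D_def v_def C_def B_def A_def p_def .
  have card: "card (solutions P Q R S) = card M" "finite (solutions P Q R S) = finite M"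
    unfolding sol by (simp_all add: card_image finite_image_iff)
  have p: "q0 p = 0" "p \<noteq> 0"
    using assms by (auto simp: p_def)
  have v0: "q0 v = 0"
    using pure_conjugate [OF p(1), of "qcnj A"] by (simp add: v_def)
  show ?thesis
  proof (cases "v = 0")
    case True
    then have "M \<subseteq> {0}"
      using p by (auto simp: M_def)
    then have "finite M" "card M \<le> 1"
      using finite_subset card_mono [of "{0 :: quat}" M] by auto
    then show ?thesis
      using card by auto
  next
    case False
    obtain Y0 where Y0: "Y0 \<noteq> 0" "Y0 * p * qcnj Y0 = v"
      using pure_conjugate_exists [OF p v0 False] by blast
    define G where "G = qcnj D"
    have M: "M = {Y \<in> span {Y0, Y0 * p}. norm Y = norm Y0 \<and> Y \<bullet> G = k - q0 P * (norm Y0)\<^sup>2}"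
      unfolding M_def G_def using pure_conjugate_solutions [OF p False Y0(2)] by auto
    have orth: "Y0 \<bullet> (Y0 * p) = 0"
      using p(1) by (simp add: inner_quat_def algebra_simps)
    have "Y0 * p \<noteq> 0"
      using Y0 p by simp
    show ?thesis
    proof (cases "Y0 \<bullet> G \<noteq> 0 \<or> (Y0 * p) \<bullet> G \<noteq> 0")
      case True
      then show ?thesis
        unfolding card M
        using card_circle_inter_hyperplane_le_two [OF \<open>Y0 \<noteq> 0\<close> \<open>Y0 * p \<noteq> 0\<close> orth] by blast
    next
      case False
      then have G: "Y0 \<bullet> G = 0" "(Y0 * p) \<bullet> G = 0"
        by auto
      have "Y \<bullet> G = 0" if "Y \<in> span {Y0, Y0 * p}" for Y
        using that G by (auto simp: span_breakdown_eq span_singleton algebra_simps)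
      then have "M = {} \<or> M = {Y \<in> span {Y0, Y0 * p}. norm Y = norm Y0}"
        unfolding M by auto
      then show ?thesis
      proof
        assume "M = {}"
        then show ?thesis
          using card by simp
      next
        assume "M = {Y \<in> span {Y0, Y0 * p}. norm Y = norm Y0}"
        then have "is_circle (solutions P Q R S)"
          unfolding sol
          using is_circle_translated_plane_circle [OF \<open>Y0 \<noteq> 0\<close> \<open>Y0 * p \<noteq> 0\<close> orth] Y0 by simp
        moreover have "degeneracy P Q R S = 0"
        proof -
          have "q0 (Y0 * D) = 0" "q0 (Y0 * p * D) = 0"
            using G unfolding G_def q0_mult_qcnj [symmetric] qcnj_simps by blast+
          then obtain c where c: "(p * D) * v * qcnj (p * D) = c *\<^sub>R p"
            using commute_conjugate_of_orthogonal [OF p(1)] Y0(2) by metis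
          have W: "(4 * (p \<bullet> p)) *\<^sub>R qim S + qcnj A * p * A = (4 * (p \<bullet> p)) *\<^sub>R v"
            using p by (simp add: v_def algebra_simps)
          have E: "p * B - q0 P *\<^sub>R A = p * D"
          proof -
            have "p * p = - (p \<bullet> p) *\<^sub>R 1"
              using pure_square [OF p(1)] by (simp add: power2_norm_eq_inner of_real_def)
            then have "p * qcnj C = - (1 / 2) *\<^sub>R A"
              using p by (simp add: C_def qcnj_pure flip: mult.assoc)
            then show ?thesis
              by (simp add: D_def distrib_left)
          qed
          have T: "(p * D) * ((4 * (p \<bullet> p)) *\<^sub>R v) * qcnj (p * D) = (4 * (p \<bullet> p) * c) *\<^sub>R p"
            using c by (simp del: qcnj_simps)
          show ?thesis
            unfolding degeneracy_def Let_def p_def [symmetric] A_def [symmetric] B_def [symmetric]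
              W E T by simp
        qed
        ultimately show ?thesis
          by blast
      qed
    qed
  qed
qed

section \<open>Real coefficients \<open>P\<close>\<close>

lemma solutions_real:
  assumes "P \<noteq> 0" "qim P = 0"
  shows "finite (solutions P Q R S) \<and> card (solutions P Q R S) \<le> 2 \<or>
    is_three_sphere (solutions P Q R S)"
proof -
  define A B where "A = Q - qcnj R" and "B = Q + qcnj R"
  have "q0 P \<noteq> 0"
    using assms by (auto simp: quat_eq_iff)
  have sol: "solutions P Q R S =
      {X. qim (X * A) = qim S \<and> q0 P * (norm X)\<^sup>2 + X \<bullet> qcnj B = q0 S}"
  proof -
    have "q0 (X * (Q + qcnj R)) = X \<bullet> qcnj B" for X
      using q0_mult_qcnj [of X "qcnj B"] by (simp only: qcnj_simps B_def)
    then show ?thesis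
      by (auto simp: solutions_iff assms A_def simp del: quat_mult_sel)
  qed
  show ?thesis
  proof (cases "A = 0")
    case True
    then have "solutions P Q R S = {} \<or>
        solutions P Q R S = {X. q0 P * (norm X)\<^sup>2 + X \<bullet> qcnj B = q0 S}"
      unfolding sol by auto
    then show ?thesis
      using three_sphere_trichotomy [OF \<open>q0 P \<noteq> 0\<close>, of "qcnj B" "q0 S"] by auto
  next
    case False
    have "solutions P Q R S \<subseteq> range (\<lambda>t. qim S * inverse A + t *\<^sub>R inverse A)"
    proof
      fix X assume "X \<in> solutions P Q R S"
      then have "qim (X * A) = qim S"
        unfolding sol by blast
      moreover have "X * A = qim (X * A) + of_real (q0 (X * A))"
        by (simp add: quat_eq_iff)
      ultimately have "X * A = qim S + of_real (q0 (X * A))"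
        by (simp only:)
      then have "X = (qim S + of_real (q0 (X * A))) * inverse A"
        using False by (metis mult.assoc mult_1_right right_inverse)
      then have "X = qim S * inverse A + q0 (X * A) *\<^sub>R inverse A"
        by (metis distrib_right quat_times_of_real(2))
      then show "X \<in> range (\<lambda>t. qim S * inverse A + t *\<^sub>R inverse A)"
        by blast
    qed
    then have "finite (solutions P Q R S) \<and> card (solutions P Q R S) \<le> 2"
      by (rule card_le_two_on_line [where c = "q0 P" and B = "qcnj B" and d = "q0 S"])
        (use False \<open>q0 P \<noteq> 0\<close> in \<open>auto simp: sol\<close>)
    then show ?thesis ..
  qed
qed

section \<open>The exceptional algebraic set\<close>

lemma generic_example:
  "degeneracy quat_i 1 1 (of_real s + 2 *\<^sub>R quat_j) \<noteq> 0"
  by (simp add: degeneracy_def Let_def quat_eq_iff inner_quat_def)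

lemma polynomial_function_quat_iff:
  fixes f :: "'a::real_normed_vector \<Rightarrow> quat"
  shows "polynomial_function f \<longleftrightarrow>
    real_polynomial_function (\<lambda>x. q0 (f x)) \<and> real_polynomial_function (\<lambda>x. q1 (f x)) \<and>
    real_polynomial_function (\<lambda>x. q2 (f x)) \<and> real_polynomial_function (\<lambda>x. q3 (f x))"
  by (simp add: polynomial_function_iff_Basis_inner Basis_quat_def inner_quat_def)

lemma polynomial_function_quat_mult:
  fixes f g :: "'a::real_normed_vector \<Rightarrow> quat"
  assumes "polynomial_function f" "polynomial_function g"
  shows "polynomial_function (\<lambda>x. f x * g x)"
  using assms unfolding polynomial_function_quat_iff quat_mult_sel
  by (intro conjI real_polynomial_function_diff
      real_polynomial_function.intros(3,4)) auto

lemma proper_algebraic_subset_degeneracy: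
  "proper_algebraic_subset {(P, Q, R, S). degeneracy P Q R S = 0}"
proof -
  define f where "f = (\<lambda>(P, Q, R, S). (norm (degeneracy P Q R S))\<^sup>2)"
  have sq: "real_polynomial_function (\<lambda>x. g x \<bullet> g x)"
    and cnj: "polynomial_function (\<lambda>x. qcnj (g x))"
    and im: "polynomial_function (\<lambda>x. qim (g x))"
    and re: "polynomial_function (\<lambda>x. q0 (g x))"
    if "polynomial_function g" for g :: "quat \<times> quat \<times> quat \<times> quat \<Rightarrow> quat"
    using that unfolding polynomial_function_quat_iff inner_quat_def
    by (auto intro!: real_polynomial_function.intros(2-4) simp flip: real_polynomial_function_eq)
  have four_sq: "polynomial_function (\<lambda>x. 4 * (g x \<bullet> g x))"
    if "polynomial_function g" for g :: "quat \<times> quat \<times> quat \<times> quat \<Rightarrow> quat"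
    using sq [OF that] real_polynomial_function.intros(2,4)
    unfolding real_polynomial_function_eq [symmetric] by blast
  have proj: "polynomial_function (\<lambda>x :: quat \<times> quat \<times> quat \<times> quat. fst x)"
    "polynomial_function (\<lambda>x :: quat \<times> quat \<times> quat \<times> quat. fst (snd x))"
    "polynomial_function (\<lambda>x :: quat \<times> quat \<times> quat \<times> quat. fst (snd (snd x)))"
    "polynomial_function (\<lambda>x :: quat \<times> quat \<times> quat \<times> quat. snd (snd (snd x)))"
    by (intro polynomial_function_bounded_linear bounded_linear_intros)+
  have "real_polynomial_function f"
    unfolding f_def case_prod_unfold power2_norm_eq_inner degeneracy_def Let_def
    by (intro sq polynomial_function_diff polynomial_function_add polynomial_function_quat_mult
        polynomial_function_mult cnj im re four_sq proj)
  moreover have "{(P, Q, R, S). degeneracy P Q R S = 0} = {x. f x = 0}"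
    by (auto simp: f_def)
  moreover have "{(P, Q, R, S). degeneracy P Q R S = 0} \<noteq> UNIV"
  proof
    assume "{(P, Q, R, S). degeneracy P Q R S = 0} = UNIV"
    then have "(quat_i, 1, 1, of_real 0 + 2 *\<^sub>R quat_j) \<in> {(P, Q, R, S). degeneracy P Q R S = 0}"
      by (simp only: UNIV_I)
    then show False
      using generic_example [of 0] by simp
  qed
  ultimately show ?thesis
    unfolding proper_algebraic_subset_def by (intro exI [of _ f] conjI)
qed

section \<open>Generic equations with two, one and no solutions\<close>

text \<open>
  The parameter \<open>s\<close> enters only the scalar part \<open>2 Re X = s\<close>.  Varying it moves a hyperplane across
  the fixed circle \<open>X i X* = 2j\<close>: it cuts the circle at \<open>s = 0\<close>, touches it at \<open>s = 2\<close> and misses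
  it at \<open>s = 4\<close>.
\<close>

lemma generic_example_solutions:
  "Quat a b c d \<in> solutions quat_i 1 1 (of_real s + 2 *\<^sub>R quat_j) \<longleftrightarrow>
    2 * a = s \<and> a\<^sup>2 + b\<^sup>2 = c\<^sup>2 + d\<^sup>2 \<and> b * c + a * d = 1 \<and> b * d = a * c"
  unfolding solutions_iff norm_quat_sq
  by (auto simp: quat_eq_iff power2_eq_square algebra_simps)

lemma generic_example_two:
  "solutions quat_i 1 1 (of_real 0 + 2 *\<^sub>R quat_j) = {Quat 0 1 1 0, Quat 0 (-1) (-1) 0}"
proof (intro set_eqI iffI)
  fix X assume X: "X \<in> solutions quat_i 1 1 (of_real 0 + 2 *\<^sub>R quat_j)"
  obtain a b c d where [simp]: "X = Quat a b c d"
    by (cases X)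
  have eqs: "a = 0" "b\<^sup>2 = c\<^sup>2 + d\<^sup>2" "b * c = 1" "b * d = 0"
    using X by (auto simp only: \<open>X = _\<close> generic_example_solutions) auto
  then have "d = 0"
    by auto
  then have "b = c \<or> b = - c"
    using eqs by (simp add: power2_eq_iff)
  then have "b = c"
    using eqs by (smt (verit) mult_minus_left zero_le_square)
  then have "b = 1 \<or> b = -1"
    using eqs by (simp add: square_eq_1_iff)
  then show "X \<in> {Quat 0 1 1 0, Quat 0 (-1) (-1) 0}"
    using eqs \<open>d = 0\<close> \<open>b = c\<close> by auto
next
  fix X assume "X \<in> {Quat 0 1 1 0, Quat 0 (-1) (-1) 0}"
  then show "X \<in> solutions quat_i 1 1 (of_real 0 + 2 *\<^sub>R quat_j)"
    by (auto simp only: insert_iff empty_iff generic_example_solutions)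
qed

lemma generic_example_one:
  "solutions quat_i 1 1 (of_real 2 + 2 *\<^sub>R quat_j) = {Quat 1 0 0 1}"
proof (intro set_eqI iffI)
  fix X assume X: "X \<in> solutions quat_i 1 1 (of_real 2 + 2 *\<^sub>R quat_j)"
  obtain a b c d where [simp]: "X = Quat a b c d"
    by (cases X)
  have "2 * a = 2 \<and> a\<^sup>2 + b\<^sup>2 = c\<^sup>2 + d\<^sup>2 \<and> b * c + a * d = 1 \<and> b * d = a * c"
    using X by (simp only: \<open>X = _\<close> generic_example_solutions)
  then have "a = 1" "1 + b\<^sup>2 = c\<^sup>2 + d\<^sup>2" "b * c + d = 1" "c = b * d"
    by auto
  have d: "d * (1 + b\<^sup>2) = 1"
    using \<open>b * c + d = 1\<close> \<open>c = b * d\<close> by (simp add: algebra_simps power2_eq_square)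
  note \<open>1 + b\<^sup>2 = c\<^sup>2 + d\<^sup>2\<close>
  also have "c\<^sup>2 + d\<^sup>2 = d * (d * (1 + b\<^sup>2))"
    by (simp add: \<open>c = b * d\<close> algebra_simps power2_eq_square)
  finally have "1 + b\<^sup>2 = d"
    using d by simp
  then have "d * d = 1" "d \<ge> 1"
    using d by auto
  then have "d = 1"
    using square_eq_1_iff [of d] by auto
  then show "X \<in> {Quat 1 0 0 1}"
    using \<open>a = 1\<close> \<open>1 + b\<^sup>2 = d\<close> \<open>c = b * d\<close> by auto
next
  fix X assume "X \<in> {Quat 1 0 0 1}"
  then show "X \<in> solutions quat_i 1 1 (of_real 2 + 2 *\<^sub>R quat_j)"
    by (auto simp only: insert_iff empty_iff generic_example_solutions)
qed

lemma generic_example_none: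
  "solutions quat_i 1 1 (of_real 4 + 2 *\<^sub>R quat_j) = {}"
proof (rule ccontr)
  assume "solutions quat_i 1 1 (of_real 4 + 2 *\<^sub>R quat_j) \<noteq> {}"
  then obtain a b c d where "Quat a b c d \<in> solutions quat_i 1 1 (of_real 4 + 2 *\<^sub>R quat_j)"
    by (metis ex_in_conv quat.exhaust)
  then have "2 * a = 4 \<and> a\<^sup>2 + b\<^sup>2 = c\<^sup>2 + d\<^sup>2 \<and> b * c + a * d = 1 \<and> b * d = a * c"
    by (simp only: generic_example_solutions)
  then have "4 + b\<^sup>2 = c\<^sup>2 + d\<^sup>2" "b * c + 2 * d = 1" "c = b * d / 2"
    by auto
  have d: "d * (4 + b\<^sup>2) = 2"
    using \<open>b * c + 2 * d = 1\<close> \<open>c = b * d / 2\<close> by (simp add: algebra_simps power2_eq_square)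
  note \<open>4 + b\<^sup>2 = c\<^sup>2 + d\<^sup>2\<close>
  also have "c\<^sup>2 + d\<^sup>2 = d * (d * (4 + b\<^sup>2)) / 4"
    by (simp add: \<open>c = b * d / 2\<close> field_simps power2_eq_square)
  finally have "2 * (4 + b\<^sup>2) = d"
    using d by simp
  then have "d * d = 4" "d \<ge> 8"
    using d by (auto simp: algebra_simps)
  then show False
    using mult_mono [of 8 d 8 d] by simp
qed

theorem theorem1:
  shows "\<exists>Z :: (quat \<times> quat \<times> quat \<times> quat) set. proper_algebraic_subset Z \<and>
    (\<forall>P Q R S. P \<noteq> 0 \<and> (P, Q, R, S) \<notin> Z \<longrightarrow>
       finite (solutions P Q R S) \<and> card (solutions P Q R S) \<in> {2, 1, 0}) \<and>
    (\<forall>n \<in> {2, 1, 0}. \<exists>P Q R S. P \<noteq> 0 \<and> (P, Q, R, S) \<notin> Z \<and>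
       finite (solutions P Q R S) \<and> card (solutions P Q R S) = n) \<and>
    (\<forall>P Q R S. P \<noteq> 0 \<longrightarrow>
       finite (solutions P Q R S) \<and> card (solutions P Q R S) \<in> {2, 1, 0} \<or>
       (P, Q, R, S) \<in> Z \<and> is_three_sphere (solutions P Q R S) \<or>
       (P, Q, R, S) \<in> Z \<and> is_circle (solutions P Q R S)) \<and>
    (\<exists>P Q R S. P \<noteq> 0 \<and> (P, Q, R, S) \<in> Z \<and> is_three_sphere (solutions P Q R S)) \<and>
    (\<exists>P Q R S. P \<noteq> 0 \<and> (P, Q, R, S) \<in> Z \<and> is_circle (solutions P Q R S))"
proof (rule exI, intro conjI)
  define Z where "Z = {(P, Q, R, S). degeneracy P Q R S = 0}"
  have small: "n \<le> 2 \<longleftrightarrow> n \<in> {2, 1, 0}" for n :: nat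
    by auto
  have classification: "finite (solutions P Q R S) \<and> card (solutions P Q R S) \<in> {2, 1, 0} \<or>
       (P, Q, R, S) \<in> Z \<and> is_three_sphere (solutions P Q R S) \<or>
       (P, Q, R, S) \<in> Z \<and> is_circle (solutions P Q R S)" if "P \<noteq> 0" for P Q R S
  proof (cases "qim P = 0")
    case True
    \<comment> \<open>A commutator with \<open>p = 0\<close> vanishes, so real \<open>P\<close> are all exceptional.\<close>
    then have "degeneracy P Q R S = 0"
      by (simp add: degeneracy_def Let_def)
    with solutions_real [OF that True, of Q R S] show ?thesis
      unfolding small by (auto simp: Z_def)
  next
    case False
    with solutions_nonreal [OF this, of Q R S] show ?thesis
      unfolding small by (auto simp: Z_def)
  qed
  have "quat_i \<noteq> 0"
    by (simp add: quat_eq_iff)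
  show "proper_algebraic_subset Z"
    unfolding Z_def by (rule proper_algebraic_subset_degeneracy)
  show "\<forall>P Q R S. P \<noteq> 0 \<and> (P, Q, R, S) \<notin> Z \<longrightarrow>
      finite (solutions P Q R S) \<and> card (solutions P Q R S) \<in> {2, 1, 0}"
    using classification by blast
  show "\<forall>P Q R S. P \<noteq> 0 \<longrightarrow>
       finite (solutions P Q R S) \<and> card (solutions P Q R S) \<in> {2, 1, 0} \<or>
       (P, Q, R, S) \<in> Z \<and> is_three_sphere (solutions P Q R S) \<or>
       (P, Q, R, S) \<in> Z \<and> is_circle (solutions P Q R S)"
    using classification by blast
  show "\<forall>n \<in> {2, 1, 0}. \<exists>P Q R S. P \<noteq> 0 \<and> (P, Q, R, S) \<notin> Z \<and>
      finite (solutions P Q R S) \<and> card (solutions P Q R S) = n"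
  proof
    fix n :: nat assume "n \<in> {2, 1, 0}"
    then have "\<exists>s. finite (solutions quat_i 1 1 (of_real s + 2 *\<^sub>R quat_j)) \<and>
        card (solutions quat_i 1 1 (of_real s + 2 *\<^sub>R quat_j)) = n"
    proof (elim insertE emptyE)
      assume "n = 2"
      then show ?thesis
        by (intro exI [of _ 0]) (simp only: generic_example_two, simp)
    next
      assume "n = 1"
      then show ?thesis
        by (intro exI [of _ 2]) (simp only: generic_example_one, simp)
    next
      assume "n = 0"
      then show ?thesis
        by (intro exI [of _ 4]) (simp only: generic_example_none, simp)
    qed
    then show "\<exists>P Q R S. P \<noteq> 0 \<and> (P, Q, R, S) \<notin> Z \<and>
        finite (solutions P Q R S) \<and> card (solutions P Q R S) = n"
      using generic_example \<open>quat_i \<noteq> 0\<close> unfolding Z_def by blast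
  qed
  show "\<exists>P Q R S. P \<noteq> 0 \<and> (P, Q, R, S) \<in> Z \<and> is_three_sphere (solutions P Q R S)"
  proof -
    have "solutions 1 0 0 1 = {X. norm (X - 0) = 1}"
      by (auto simp: solutions_def mult_qcnj abs_square_eq_1 simp flip: of_real_power)
    then have "is_three_sphere (solutions 1 0 0 1)"
      unfolding is_three_sphere_def by (intro exI [of _ 0] exI [of _ 1]) simp
    moreover have "(1, 0, 0, 1) \<in> Z"
      by (simp add: Z_def degeneracy_def Let_def quat_eq_iff inner_quat_def)
    ultimately show ?thesis
      by (metis zero_neq_one)
  qed
  show "\<exists>P Q R S. P \<noteq> 0 \<and> (P, Q, R, S) \<in> Z \<and> is_circle (solutions P Q R S)"
  proof -
    \<comment> \<open>\<open>Y i Y* = i\<close> describes the unit circle of the plane spanned by \<open>1\<close> and \<open>i\<close>.\<close>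
    have "solutions quat_i 0 0 quat_i = (+) 0 ` {Y \<in> span {1, 1 * quat_i}. norm Y = 1}"
      using pure_conjugate_solutions [of quat_i quat_i 1]
      by (auto simp: solutions_def \<open>quat_i \<noteq> 0\<close> qcnj_def one_quat_def [symmetric])
    then have "is_circle (solutions quat_i 0 0 quat_i)"
      using is_circle_translated_plane_circle [of 1 quat_i 1 0] \<open>quat_i \<noteq> 0\<close>
      by (simp add: inner_quat_def)
    moreover have "(quat_i, 0, 0, quat_i) \<in> Z"
      by (simp add: Z_def degeneracy_def Let_def)
    ultimately show ?thesis
      using \<open>quat_i \<noteq> 0\<close> by blast
  qed
qed

end
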